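(* Let $X_1,X_2,Z_1,Z_2$ be diffeological spaces, let $f:X_1\supset Y\to X_2$ and $g:Z_1\supset Y'\to Z_2$ be smooth maps. Then the map $$\mathcal{F}_{Z_1,Z_2}:C^\infty(X_1,Z_1)\times_{comp}C^\infty(X_2,Z_2)\to C^\infty(X_1\cup_fX_2,Z_1\cup_gZ_2),\qquad(\psi_1,\psi_2)\mapsto\psi_1\cup_{(f,g)}\psi_2,$$ is smooth, where $C^\infty(X_1,Z_1)\times_{comp}C^\infty(X_2,Z_2)$ is the set of all pairs of $(f,g)$-compatible smooth maps.
   Context: A diffeological space is a set $X$ with a collection of maps (plots) $U\to X$, $U$ open in some $\mathbb{R}^n$, containing constant maps, closed under precomposition with usual smooth maps, and satisfying the sheaf condition. A map is smooth if it carries plots to plots. Subsets carry the subset diffeology (plots with image in the subset), products the product diffeology (componentwise plots), quotients the quotient diffeology (maps locally lifting to plots), disjoint unions the disjoint union diffeology (maps locally equal to plots of one component). $C^\infty(X,Z)$ is the set of smooth maps $X\to Z$ with the functional diffeology: $p:U\to C^\infty(X,Z)$ is a plot iff for every plot $q:U'\to X$ the map $(u,u')\mapsto p(u)(q(u'))$ is a plot of $Z$. For a smooth map $f:X_1\supset Y\to X_2$ ($Y$ with the subset diffeology), $X_1\cup_fX_2=(X_1\sqcup X_2)/\sim$, with $\sim$ generated by $y\sim f(y)$, $y\in Y$, carries the quotient diffeology of the disjoint union diffeology; similarly for $Z_1\cup_gZ_2$. Let $i_1:X_1\setminus Y\hookrightarrow X_1\cup_fX_2$ and $i_2:X_2\hookrightarrow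 X_1\cup_fX_2$ be the maps induced by the inclusions; they are injective with images disjointly covering $X_1\cup_fX_2$. Let $j_1:Z_1\to Z_1\cup_gZ_2$ and $j_2:Z_2\to Z_1\cup_gZ_2$ be the natural maps (inclusion into $Z_1\sqcup Z_2$ followed by the quotient projection). Smooth maps $\psi_1:X_1\to Z_1$ and $\psi_2:X_2\to Z_2$ are $(f,g)$-compatible if $\psi_1(Y)=Y'$ and $g(\psi_1(y))=\psi_2(f(y))$ for all $y\in Y$. For such maps $\psi_1\cup_{(f,g)}\psi_2:X_1\cup_fX_2\to Z_1\cup_gZ_2$ is the (smooth) map equal to $j_1(\psi_1(i_1^{-1}(x)))$ for $x\in i_1(X_1\setminus Y)$ and to $j_2(\psi_2(i_2^{-1}(x)))$ for $x\in i_2(X_2)$. The set of $(f,g)$-compatible pairs has the subset diffeology from the product $C^\infty(X_1,Z_1)\times C^\infty(X_2,Z_2)$ of functional diffeologies. *)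

theory Defs
  imports "HOL-Analysis.Analysis"
begin

section \<open>Smooth maps between open subsets of Euclidean spaces\<close>

text \<open>
  Plots of one and the same space have domains in \<open>\<real>\<^sup>n\<close> for varying \<open>n\<close>, so \<open>\<real>\<^sup>n\<close> is
  \<^const>\<open>Euclidean_space\<close> \<open>n\<close>: the sequences vanishing from index \<open>n\<close> on, with the subspace
  topology of the product topology.
\<close>

text \<open>
  \<open>Ck k n U \<phi>\<close>: on the open set \<open>U\<close> of \<open>\<real>\<^sup>n\<close>, all iterated partial derivatives of \<open>\<phi>\<close> of
  order at most \<open>k\<close> exist and are continuous. In the successor case \<open>\<phi>'\<close> is the \<open>i\<close>-th partial
  derivative of \<open>\<phi>\<close> on \<open>U\<close>; its values outside \<open>U\<close> are irrelevant.
\<close>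

primrec Ck :: "nat \<Rightarrow> nat \<Rightarrow> (nat \<Rightarrow> real) set \<Rightarrow> ((nat \<Rightarrow> real) \<Rightarrow> real) \<Rightarrow> bool" where
  "Ck 0 n U \<phi> \<longleftrightarrow> continuous_map (subtopology (Euclidean_space n) U) euclideanreal \<phi>"
| "Ck (Suc k) n U \<phi> \<longleftrightarrow>
     continuous_map (subtopology (Euclidean_space n) U) euclideanreal \<phi> \<and>
     (\<forall>i<n. \<exists>\<phi>'. (\<forall>x\<in>U. ((\<lambda>t. \<phi> (x(i := t))) has_real_derivative \<phi>' x) (at (x i))) \<and>
                 Ck k n U \<phi>')"

definition smooth_between ::
  "nat \<Rightarrow> (nat \<Rightarrow> real) set \<Rightarrow> nat \<Rightarrow> (nat \<Rightarrow> real) set \<Rightarrow> ((nat \<Rightarrow> real) \<Rightarrow> (nat \<Rightarrow> real)) \<Rightarrow> bool" where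
  "smooth_between m V n U h \<longleftrightarrow> h \<in> V \<rightarrow> U \<and> (\<forall>j<n. \<forall>k. Ck k m V (\<lambda>x. h x j))"

text \<open>The two components of a point of \<open>\<real>\<^sup>n\<^sup>+\<^sup>m = \<real>\<^sup>n \<times> \<real>\<^sup>m\<close>, and products of subsets.\<close>

definition left_part :: "nat \<Rightarrow> (nat \<Rightarrow> real) \<Rightarrow> (nat \<Rightarrow> real)" where
  "left_part n w = (\<lambda>i. if i < n then w i else 0)"

definition right_part :: "nat \<Rightarrow> (nat \<Rightarrow> real) \<Rightarrow> (nat \<Rightarrow> real)" where
  "right_part n w = (\<lambda>i. w (n + i))"

definition box_product ::
  "nat \<Rightarrow> (nat \<Rightarrow> real) set \<Rightarrow> nat \<Rightarrow> (nat \<Rightarrow> real) set \<Rightarrow> (nat \<Rightarrow> real) set" where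
  "box_product n U m U' =
     {w \<in> topspace (Euclidean_space (n + m)). left_part n w \<in> U \<and> right_part n w \<in> U'}"

section \<open>Diffeological spaces\<close>

text \<open>
  \<open>plots X n U\<close> is the set of plots with domain \<open>U\<close>, an open subset of \<open>\<real>\<^sup>n\<close>. A plot is
  represented by any total function with the right values on \<open>U\<close>, which is what the condition
  \<open>plot_cong\<close> expresses.
\<close>

record 'a dspace =
  points :: "'a set"
  plots :: "nat \<Rightarrow> (nat \<Rightarrow> real) set \<Rightarrow> ((nat \<Rightarrow> real) \<Rightarrow> 'a) set"

locale diffeological_space =
  fixes X :: "'a dspace"
  assumes plot_domain: "p \<in> plots X n U \<Longrightarrow> openin (Euclidean_space n) U"
    and plot_values: "p \<in> plots X n U \<Longrightarrow> p \<in> U \<rightarrow> points X"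
    and plot_cong: "\<lbrakk>p \<in> plots X n U; \<And>u. u \<in> U \<Longrightarrow> p' u = p u\<rbrakk> \<Longrightarrow> p' \<in> plots X n U"
    and plot_const: "\<lbrakk>openin (Euclidean_space n) U; x \<in> points X\<rbrakk> \<Longrightarrow> (\<lambda>u. x) \<in> plots X n U"
    and plot_compose: "\<lbrakk>p \<in> plots X n U; openin (Euclidean_space m) V; smooth_between m V n U h\<rbrakk>
           \<Longrightarrow> p \<circ> h \<in> plots X m V"
    and plot_sheaf: "\<lbrakk>openin (Euclidean_space n) U; p \<in> U \<rightarrow> points X;
           \<And>u. u \<in> U \<Longrightarrow> \<exists>V. openin (Euclidean_space n) V \<and> u \<in> V \<and> V \<subseteq> U \<and> p \<in> plots X n V\<rbrakk>
           \<Longrightarrow> p \<in> plots X n U"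

definition smooth_map :: "'a dspace \<Rightarrow> 'b dspace \<Rightarrow> ('a \<Rightarrow> 'b) \<Rightarrow> bool" where
  "smooth_map X Z f \<longleftrightarrow>
     f \<in> points X \<rightarrow> points Z \<and> (\<forall>n U. \<forall>p\<in>plots X n U. f \<circ> p \<in> plots Z n U)"

section \<open>Constructions\<close>

text \<open>
  \<open>sub_dspace X A\<close> is meant for \<open>A \<subseteq> points X\<close>, and \<open>quot_dspace X R\<close> for an equivalence
  relation \<open>R\<close> on \<open>points X\<close>.
\<close>

definition sub_dspace :: "'a dspace \<Rightarrow> 'a set \<Rightarrow> 'a dspace" where
  "sub_dspace X A = \<lparr>points = A, plots = (\<lambda>n U. {p \<in> plots X n U. p ` U \<subseteq> A})\<rparr>"

definition prod_dspace :: "'a dspace \<Rightarrow> 'b dspace \<Rightarrow> ('a \<times> 'b) dspace" where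
  "prod_dspace X Z =
     \<lparr>points = points X \<times> points Z,
      plots = (\<lambda>n U. {p. fst \<circ> p \<in> plots X n U \<and> snd \<circ> p \<in> plots Z n U})\<rparr>"

definition sum_dspace :: "'a dspace \<Rightarrow> 'b dspace \<Rightarrow> ('a + 'b) dspace" where
  "sum_dspace X Z =
     \<lparr>points = points X <+> points Z,
      plots = (\<lambda>n U. {p. openin (Euclidean_space n) U \<and>
        (\<forall>u\<in>U. \<exists>V. openin (Euclidean_space n) V \<and> u \<in> V \<and> V \<subseteq> U \<and>
           ((\<exists>q\<in>plots X n V. \<forall>v\<in>V. p v = Inl (q v)) \<or>
            (\<exists>q\<in>plots Z n V. \<forall>v\<in>V. p v = Inr (q v))))})\<rparr>"

definition quot_dspace :: "'a dspace \<Rightarrow> ('a \<times> 'a) set \<Rightarrow> 'a set dspace" where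
  "quot_dspace X R =
     \<lparr>points = points X // R,
      plots = (\<lambda>n U. {p. openin (Euclidean_space n) U \<and>
        (\<forall>u\<in>U. \<exists>V. openin (Euclidean_space n) V \<and> u \<in> V \<and> V \<subseteq> U \<and>
           (\<exists>q\<in>plots X n V. \<forall>v\<in>V. p v = R `` {q v}))})\<rparr>"

text \<open>
  Elements of \<open>C\<^sup>\<infinity>(X, Z)\<close> are extensional, so that equality of elements is equality of maps
  on \<open>points X\<close>.
\<close>

definition smooth_maps :: "'a dspace \<Rightarrow> 'b dspace \<Rightarrow> ('a \<Rightarrow> 'b) set" where
  "smooth_maps X Z = {f \<in> extensional (points X). smooth_map X Z f}"

definition fun_dspace :: "'a dspace \<Rightarrow> 'b dspace \<Rightarrow> ('a \<Rightarrow> 'b) dspace" where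
  "fun_dspace X Z =
     \<lparr>points = smooth_maps X Z,
      plots = (\<lambda>n U. {p. openin (Euclidean_space n) U \<and> p \<in> U \<rightarrow> smooth_maps X Z \<and>
        (\<forall>m U'. \<forall>q\<in>plots X m U'.
           (\<lambda>w. p (left_part n w) (q (right_part n w))) \<in> plots Z (n + m) (box_product n U m U'))})\<rparr>"

section \<open>Gluing\<close>

text \<open>
  Throughout, \<open>f\<close> is a map \<open>X\<^sub>1 \<supseteq> Y \<rightarrow> X\<^sub>2\<close>; its values outside \<open>Y\<close> are irrelevant.
\<close>

definition glue_rel ::
  "'a dspace \<Rightarrow> 'a set \<Rightarrow> ('a \<Rightarrow> 'b) \<Rightarrow> 'b dspace \<Rightarrow> (('a + 'b) \<times> ('a + 'b)) set" where
  "glue_rel X1 Y f X2 =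
     {(a, b). a \<in> points (sum_dspace X1 X2) \<and> b \<in> points (sum_dspace X1 X2) \<and>
        equivclp (\<lambda>s t. \<exists>y\<in>Y. s = Inl y \<and> t = Inr (f y)) a b}"

definition glue :: "'a dspace \<Rightarrow> 'a set \<Rightarrow> ('a \<Rightarrow> 'b) \<Rightarrow> 'b dspace \<Rightarrow> ('a + 'b) set dspace" where
  "glue X1 Y f X2 = quot_dspace (sum_dspace X1 X2) (glue_rel X1 Y f X2)"

text \<open>
  The natural maps from \<open>X\<^sub>1\<close> and \<open>X\<^sub>2\<close> to \<open>X\<^sub>1 \<union>\<^sub>f X\<^sub>2\<close>. They serve as \<open>j\<^sub>1\<close>, \<open>j\<^sub>2\<close>, and
  also as \<open>i\<^sub>1\<close> (restricted to \<open>X\<^sub>1 - Y\<close>) and \<open>i\<^sub>2\<close>.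
\<close>

definition glue_in1 ::
  "'a dspace \<Rightarrow> 'a set \<Rightarrow> ('a \<Rightarrow> 'b) \<Rightarrow> 'b dspace \<Rightarrow> 'a \<Rightarrow> ('a + 'b) set" where
  "glue_in1 X1 Y f X2 x = glue_rel X1 Y f X2 `` {Inl x}"

definition glue_in2 ::
  "'a dspace \<Rightarrow> 'a set \<Rightarrow> ('a \<Rightarrow> 'b) \<Rightarrow> 'b dspace \<Rightarrow> 'b \<Rightarrow> ('a + 'b) set" where
  "glue_in2 X1 Y f X2 x = glue_rel X1 Y f X2 `` {Inr x}"

text \<open>
  In \<open>compatible_pairs\<close> and \<open>glue_map\<close>, \<open>g\<close> is a map \<open>Z\<^sub>1 \<supseteq> Y' \<rightarrow> Z\<^sub>2\<close>.
\<close>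

definition compatible_pairs ::
  "'a dspace \<Rightarrow> 'a set \<Rightarrow> ('a \<Rightarrow> 'b) \<Rightarrow> 'b dspace \<Rightarrow> 'c dspace \<Rightarrow> 'c set \<Rightarrow> ('c \<Rightarrow> 'd) \<Rightarrow> 'd dspace
     \<Rightarrow> (('a \<Rightarrow> 'c) \<times> ('b \<Rightarrow> 'd)) set" where
  "compatible_pairs X1 Y f X2 Z1 Y' g Z2 =
     {(\<psi>1, \<psi>2). \<psi>1 \<in> smooth_maps X1 Z1 \<and> \<psi>2 \<in> smooth_maps X2 Z2 \<and>
        \<psi>1 ` Y = Y' \<and> (\<forall>y\<in>Y. g (\<psi>1 y) = \<psi>2 (f y))}"

definition compatible_dspace ::
  "'a dspace \<Rightarrow> 'a set \<Rightarrow> ('a \<Rightarrow> 'b) \<Rightarrow> 'b dspace \<Rightarrow> 'c dspace \<Rightarrow> 'c set \<Rightarrow> ('c \<Rightarrow> 'd) \<Rightarrow> 'd dspace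
     \<Rightarrow> (('a \<Rightarrow> 'c) \<times> ('b \<Rightarrow> 'd)) dspace" where
  "compatible_dspace X1 Y f X2 Z1 Y' g Z2 =
     sub_dspace (prod_dspace (fun_dspace X1 Z1) (fun_dspace X2 Z2))
       (compatible_pairs X1 Y f X2 Z1 Y' g Z2)"

text \<open>
  Since \<open>X\<^sub>1 \<union>\<^sub>f X\<^sub>2\<close> is the disjoint union of \<open>i\<^sub>1 (X\<^sub>1 - Y)\<close> and \<open>i\<^sub>2 (X\<^sub>2)\<close>, the second
  branch is the case \<open>c \<in> i\<^sub>2 (X\<^sub>2)\<close>.
\<close>

definition glue_map ::
  "'a dspace \<Rightarrow> 'a set \<Rightarrow> ('a \<Rightarrow> 'b) \<Rightarrow> 'b dspace \<Rightarrow> 'c dspace \<Rightarrow> 'c set \<Rightarrow> ('c \<Rightarrow> 'd) \<Rightarrow> 'd dspace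
     \<Rightarrow> ('a \<Rightarrow> 'c) \<Rightarrow> ('b \<Rightarrow> 'd) \<Rightarrow> ('a + 'b) set \<Rightarrow> ('c + 'd) set" where
  "glue_map X1 Y f X2 Z1 Y' g Z2 \<psi>1 \<psi>2 =
     (\<lambda>c\<in>points (glue X1 Y f X2).
        if c \<in> glue_in1 X1 Y f X2 ` (points X1 - Y)
        then glue_in1 Z1 Y' g Z2 (\<psi>1 (inv_into (points X1 - Y) (glue_in1 X1 Y f X2) c))
        else glue_in2 Z1 Y' g Z2 (\<psi>2 (inv_into (points X2) (glue_in2 X1 Y f X2) c)))"

end

theory Submission
  imports Defs
begin

text \<open>
  A plot of a glued space \<open>X\<^sub>1 \<union>\<^sub>f X\<^sub>2\<close> is, near each point of its domain, a plot of \<open>X\<^sub>1\<close> or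
  of \<open>X\<^sub>2\<close> followed by the natural map into the glued space (\<open>plots_glue_iff\<close>): a quotient plot
  lifts locally to the disjoint union, and a plot of the disjoint union stays locally in one
  component. The map glued from a compatible pair \<open>(\<psi>\<^sub>1, \<psi>\<^sub>2)\<close> acts on the image of all of
  \<open>X\<^sub>1\<close> as \<open>\<psi>\<^sub>1\<close> and on the image of \<open>X\<^sub>2\<close> as \<open>\<psi>\<^sub>2\<close> (\<open>glue_map_in1\<close>, \<open>glue_map_in2\<close>). The
  definition gives this for \<open>X\<^sub>1 - Y\<close> and \<open>X\<^sub>2\<close> only; on \<open>Y\<close> it is what compatibility says.

  Now let \<open>p\<close> be a plot of compatible pairs and \<open>q\<close> a plot of \<open>X\<^sub>1 \<union>\<^sub>f X\<^sub>2\<close>. Near a given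
  parameter, \<open>q\<close> comes from a plot \<open>r\<close> of one component \<open>X\<^sub>i\<close>. So the evaluation of the glued
  maps along \<open>q\<close> comes from the evaluation of the \<open>i\<close>-th component of \<open>p\<close> along \<open>r\<close>, which is a
  plot of \<open>Z\<^sub>i\<close> by the definition of the functional diffeology. Lifting over all of \<open>X\<^sub>1\<close> matters
  here: \<open>r\<close> may run in and out of \<open>Y\<close>, and its restriction to the preimage of \<open>X\<^sub>1 - Y\<close> need not
  have an open domain.
\<close>

section \<open>Points of a glued space\<close>

text \<open>
  A normal form for the gluing relation: every point of \<open>Y\<close> is replaced by its image in
  \<open>X\<^sub>2\<close>, so that each class has one representative in \<open>(X\<^sub>1 - Y) \<squnion> X\<^sub>2\<close>.
\<close>

definition glue_rep :: "'a set \<Rightarrow> ('a \<Rightarrow> 'b) \<Rightarrow> 'a + 'b \<Rightarrow> 'a + 'b" where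
  "glue_rep Y f s = (case s of Inl x \<Rightarrow> if x \<in> Y then Inr (f x) else Inl x | Inr x \<Rightarrow> Inr x)"

lemma equivclp_glue_iff:
  "equivclp (\<lambda>s t. \<exists>y\<in>Y. s = Inl y \<and> t = Inr (f y)) a b \<longleftrightarrow> glue_rep Y f a = glue_rep Y f b"
    (is "equivclp ?r a b \<longleftrightarrow> _")
proof
  assume "equivclp ?r a b"
  then show "glue_rep Y f a = glue_rep Y f b"
    by (induction rule: equivclp_induct) (auto simp: glue_rep_def)
next
  assume eq: "glue_rep Y f a = glue_rep Y f b"
  have rep: "equivclp ?r s (glue_rep Y f s)" for s
  proof (cases "\<exists>y\<in>Y. s = Inl y")
    case True
    then show ?thesis by (intro r_into_equivclp) (auto simp: glue_rep_def)
  next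
    case False
    then have "glue_rep Y f s = s" by (auto simp: glue_rep_def split: sum.split)
    then show ?thesis by simp
  qed
  have "equivclp ?r a (glue_rep Y f b)"
    using rep[of a] by (simp only: eq)
  then show "equivclp ?r a b"
    using rep[of b] by (meson equivclp_sym equivclp_trans)
qed

lemma glue_rel_Image_eq_iff:
  assumes "a \<in> points (sum_dspace X1 X2)" "b \<in> points (sum_dspace X1 X2)"
  shows "glue_rel X1 Y f X2 `` {a} = glue_rel X1 Y f X2 `` {b} \<longleftrightarrow> glue_rep Y f a = glue_rep Y f b"
  using assms unfolding glue_rel_def equivclp_glue_iff by auto

lemma points_sum_dspace: "points (sum_dspace X1 X2) = points X1 <+> points X2"
  by (simp add: sum_dspace_def)

lemma Inl_in_points_sum_dspace: "Inl x \<in> points (sum_dspace X1 X2) \<longleftrightarrow> x \<in> points X1"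
  by (auto simp: points_sum_dspace)

lemma Inr_in_points_sum_dspace: "Inr x \<in> points (sum_dspace X1 X2) \<longleftrightarrow> x \<in> points X2"
  by (auto simp: points_sum_dspace)

lemma points_glue:
  "points (glue X1 Y f X2) =
     glue_in1 X1 Y f X2 ` points X1 \<union> glue_in2 X1 Y f X2 ` points X2"
  by (auto simp: glue_def quot_dspace_def quotient_def points_sum_dspace glue_in1_def glue_in2_def)

lemma glue_in1_eq_glue_in2:
  assumes "Y \<subseteq> points X1" "f \<in> Y \<rightarrow> points X2" "y \<in> Y"
  shows "glue_in1 X1 Y f X2 y = glue_in2 X1 Y f X2 (f y)"
proof -
  have "y \<in> points X1" "f y \<in> points X2"
    using assms by auto
  then show ?thesis
    using \<open>y \<in> Y\<close> unfolding glue_in1_def glue_in2_def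
    by (subst glue_rel_Image_eq_iff) (auto simp: Inl_in_points_sum_dspace Inr_in_points_sum_dspace glue_rep_def)
qed

lemma inj_on_glue_in1: "inj_on (glue_in1 X1 Y f X2) (points X1 - Y)"
  by (rule inj_onI)
    (auto simp: glue_in1_def glue_rel_Image_eq_iff glue_rep_def Inl_in_points_sum_dspace
      Inr_in_points_sum_dspace)

lemma inj_on_glue_in2: "inj_on (glue_in2 X1 Y f X2) (points X2)"
  by (rule inj_onI)
    (auto simp: glue_in2_def glue_rel_Image_eq_iff glue_rep_def Inl_in_points_sum_dspace
      Inr_in_points_sum_dspace)

lemma glue_in2_notin_glue_in1:
  assumes "x \<in> points X2"
  shows "glue_in2 X1 Y f X2 x \<notin> glue_in1 X1 Y f X2 ` (points X1 - Y)"
  using assms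
  by (auto simp: glue_in1_def glue_in2_def glue_rel_Image_eq_iff glue_rep_def Inl_in_points_sum_dspace
      Inr_in_points_sum_dspace)

section \<open>Plots of a glued space\<close>

lemma plots_glue_iff:
  "p \<in> plots (glue X1 Y f X2) n U \<longleftrightarrow>
     openin (Euclidean_space n) U \<and>
     (\<forall>u\<in>U. \<exists>V. openin (Euclidean_space n) V \<and> u \<in> V \<and> V \<subseteq> U \<and>
        ((\<exists>r\<in>plots X1 n V. \<forall>v\<in>V. p v = glue_in1 X1 Y f X2 (r v)) \<or>
         (\<exists>r\<in>plots X2 n V. \<forall>v\<in>V. p v = glue_in2 X1 Y f X2 (r v))))"
    (is "_ \<longleftrightarrow> _ \<and> (\<forall>u\<in>U. \<exists>V. ?local u V)")
proof
  assume p: "p \<in> plots (glue X1 Y f X2) n U"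
  have "\<exists>V. ?local u V" if u: "u \<in> U" for u
  proof -
    obtain V q where V: "openin (Euclidean_space n) V" "u \<in> V" "V \<subseteq> U"
      and q: "q \<in> plots (sum_dspace X1 X2) n V"
      and pq: "\<forall>v\<in>V. p v = glue_rel X1 Y f X2 `` {q v}"
      using p u unfolding glue_def quot_dspace_def by auto
    obtain W where W: "openin (Euclidean_space n) W" "u \<in> W" "W \<subseteq> V"
      and qW: "(\<exists>r\<in>plots X1 n W. \<forall>v\<in>W. q v = Inl (r v)) \<or>
               (\<exists>r\<in>plots X2 n W. \<forall>v\<in>W. q v = Inr (r v))"
      using q V(2) unfolding sum_dspace_def by simp blast
    have "(\<exists>r\<in>plots X1 n W. \<forall>v\<in>W. p v = glue_in1 X1 Y f X2 (r v)) \<or>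
          (\<exists>r\<in>plots X2 n W. \<forall>v\<in>W. p v = glue_in2 X1 Y f X2 (r v))"
      using qW
    proof
      assume "\<exists>r\<in>plots X1 n W. \<forall>v\<in>W. q v = Inl (r v)"
      then obtain r where "r \<in> plots X1 n W" "\<forall>v\<in>W. q v = Inl (r v)" by blast
      moreover from this have "\<forall>v\<in>W. p v = glue_in1 X1 Y f X2 (r v)"
        using pq W(3) by (auto simp: glue_in1_def)
      ultimately show ?thesis by blast
    next
      assume "\<exists>r\<in>plots X2 n W. \<forall>v\<in>W. q v = Inr (r v)"
      then obtain r where "r \<in> plots X2 n W" "\<forall>v\<in>W. q v = Inr (r v)" by blast
      moreover from this have "\<forall>v\<in>W. p v = glue_in2 X1 Y f X2 (r v)"
        using pq W(3) by (auto simp: glue_in2_def)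
      ultimately show ?thesis by blast
    qed
    then show ?thesis
      using W V(3) by blast
  qed
  moreover have "openin (Euclidean_space n) U"
    using p by (simp add: glue_def quot_dspace_def)
  ultimately show "openin (Euclidean_space n) U \<and> (\<forall>u\<in>U. \<exists>V. ?local u V)"
    by blast
next
  assume R: "openin (Euclidean_space n) U \<and> (\<forall>u\<in>U. \<exists>V. ?local u V)"
  have "\<exists>V. openin (Euclidean_space n) V \<and> u \<in> V \<and> V \<subseteq> U \<and>
          (\<exists>q\<in>plots (sum_dspace X1 X2) n V. \<forall>v\<in>V. p v = glue_rel X1 Y f X2 `` {q v})"
    if "u \<in> U" for u
  proof -
    obtain V where V: "openin (Euclidean_space n) V" "u \<in> V" "V \<subseteq> U"
      and alt: "(\<exists>r\<in>plots X1 n V. \<forall>v\<in>V. p v = glue_in1 X1 Y f X2 (r v)) \<or>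
                (\<exists>r\<in>plots X2 n V. \<forall>v\<in>V. p v = glue_in2 X1 Y f X2 (r v))"
      using R \<open>u \<in> U\<close> by blast
    have "\<exists>q\<in>plots (sum_dspace X1 X2) n V. \<forall>v\<in>V. p v = glue_rel X1 Y f X2 `` {q v}"
      using alt
    proof
      assume "\<exists>r\<in>plots X1 n V. \<forall>v\<in>V. p v = glue_in1 X1 Y f X2 (r v)"
      then obtain r where r: "r \<in> plots X1 n V" "\<forall>v\<in>V. p v = glue_in1 X1 Y f X2 (r v)" by blast
      then have "(\<lambda>v. Inl (r v)) \<in> plots (sum_dspace X1 X2) n V"
        using V(1) unfolding sum_dspace_def by auto
      then show ?thesis
        using r(2) unfolding glue_in1_def by (intro bexI[of _ "\<lambda>v. Inl (r v)"])
    next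
      assume "\<exists>r\<in>plots X2 n V. \<forall>v\<in>V. p v = glue_in2 X1 Y f X2 (r v)"
      then obtain r where r: "r \<in> plots X2 n V" "\<forall>v\<in>V. p v = glue_in2 X1 Y f X2 (r v)" by blast
      then have "(\<lambda>v. Inr (r v)) \<in> plots (sum_dspace X1 X2) n V"
        using V(1) unfolding sum_dspace_def by auto
      then show ?thesis
        using r(2) unfolding glue_in2_def by (intro bexI[of _ "\<lambda>v. Inr (r v)"])
    qed
    then show ?thesis
      using V by blast
  qed
  then show "p \<in> plots (glue X1 Y f X2) n U"
    using R by (simp add: glue_def quot_dspace_def)
qed

section \<open>Gluing a compatible pair\<close>

lemma glue_map_in2:
  assumes "x \<in> points X2"
  shows "glue_map X1 Y f X2 Z1 Y' g Z2 \<psi>1 \<psi>2 (glue_in2 X1 Y f X2 x) = glue_in2 Z1 Y' g Z2 (\<psi>2 x)"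
  using assms
  by (simp add: glue_map_def points_glue inv_into_f_f inj_on_glue_in2 glue_in2_notin_glue_in1)

text \<open>
  A point of \<open>Y\<close> falls under the second branch of the definition of \<open>glue_map\<close>, as a point of
  \<open>X\<^sub>2\<close>. Compatibility makes the value found there agree with \<open>\<psi>\<^sub>1\<close>, because \<open>\<psi>\<^sub>1 y\<close> is glued
  to \<open>g (\<psi>\<^sub>1 y) = \<psi>\<^sub>2 (f y)\<close>.
\<close>

lemma glue_map_in1:
  assumes "Y \<subseteq> points X1" "f \<in> Y \<rightarrow> points X2" "Y' \<subseteq> points Z1" "g \<in> Y' \<rightarrow> points Z2"
    and comp: "(\<psi>1, \<psi>2) \<in> compatible_pairs X1 Y f X2 Z1 Y' g Z2"
    and x: "x \<in> points X1"
  shows "glue_map X1 Y f X2 Z1 Y' g Z2 \<psi>1 \<psi>2 (glue_in1 X1 Y f X2 x) = glue_in1 Z1 Y' g Z2 (\<psi>1 x)"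
proof (cases "x \<in> Y")
  case True
  then have "\<psi>1 x \<in> Y'" and g: "g (\<psi>1 x) = \<psi>2 (f x)"
    using comp by (auto simp: compatible_pairs_def)
  have "f x \<in> points X2"
    using True assms(2) by auto
  then have "glue_map X1 Y f X2 Z1 Y' g Z2 \<psi>1 \<psi>2 (glue_in1 X1 Y f X2 x)
      = glue_in2 Z1 Y' g Z2 (\<psi>2 (f x))"
    by (simp add: glue_in1_eq_glue_in2[OF assms(1,2) True] glue_map_in2)
  also have "\<dots> = glue_in1 Z1 Y' g Z2 (\<psi>1 x)"
    by (simp add: glue_in1_eq_glue_in2[OF assms(3,4) \<open>\<psi>1 x \<in> Y'\<close>] g)
  finally show ?thesis .
next
  case False
  then show ?thesis
    using x by (simp add: glue_map_def points_glue inv_into_f_f inj_on_glue_in1)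
qed

text \<open>
  A family of maps can be a plot of the functional diffeology only if each member is smooth. This
  is the argument for families with the parameter removed: smoothness of \<open>\<psi>\<^sub>i\<close> takes the place
  of the evaluation plot.
\<close>

lemma glue_map_smooth:
  assumes X: "diffeological_space X1" "diffeological_space X2"
    and glue: "Y \<subseteq> points X1" "f \<in> Y \<rightarrow> points X2" "Y' \<subseteq> points Z1" "g \<in> Y' \<rightarrow> points Z2"
    and comp: "(\<psi>1, \<psi>2) \<in> compatible_pairs X1 Y f X2 Z1 Y' g Z2"
  shows "glue_map X1 Y f X2 Z1 Y' g Z2 \<psi>1 \<psi>2 \<in> smooth_maps (glue X1 Y f X2) (glue Z1 Y' g Z2)"
    (is "?F \<in> _")
proof -
  note F_in1 = glue_map_in1[OF glue comp]
  have smooth: "smooth_map X1 Z1 \<psi>1" "smooth_map X2 Z2 \<psi>2"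
    using comp by (auto simp: compatible_pairs_def smooth_maps_def)
  have "?F \<in> points (glue X1 Y f X2) \<rightarrow> points (glue Z1 Y' g Z2)"
  proof
    fix c assume "c \<in> points (glue X1 Y f X2)"
    then consider (1) x where "x \<in> points X1" "c = glue_in1 X1 Y f X2 x"
      | (2) x where "x \<in> points X2" "c = glue_in2 X1 Y f X2 x"
      by (auto simp: points_glue)
    then show "?F c \<in> points (glue Z1 Y' g Z2)"
    proof cases
      case 1
      then have "\<psi>1 x \<in> points Z1" using smooth(1) by (auto simp: smooth_map_def)
      then show ?thesis using 1 by (simp add: F_in1 points_glue)
    next
      case 2
      then have "\<psi>2 x \<in> points Z2" using smooth(2) by (auto simp: smooth_map_def)
      then show ?thesis using 2 by (simp add: glue_map_in2 points_glue)
    qed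
  qed
  moreover have "?F \<circ> q \<in> plots (glue Z1 Y' g Z2) n U" if "q \<in> plots (glue X1 Y f X2) n U" for q n U
    unfolding plots_glue_iff
  proof (intro conjI ballI)
    show "openin (Euclidean_space n) U"
      using that by (simp add: plots_glue_iff)
    fix u assume "u \<in> U"
    then obtain V where V: "openin (Euclidean_space n) V" "u \<in> V" "V \<subseteq> U"
      and alt: "(\<exists>r\<in>plots X1 n V. \<forall>v\<in>V. q v = glue_in1 X1 Y f X2 (r v)) \<or>
                (\<exists>r\<in>plots X2 n V. \<forall>v\<in>V. q v = glue_in2 X1 Y f X2 (r v))"
      using \<open>q \<in> plots (glue X1 Y f X2) n U\<close> unfolding plots_glue_iff by blast
    have "(\<exists>s\<in>plots Z1 n V. \<forall>v\<in>V. (?F \<circ> q) v = glue_in1 Z1 Y' g Z2 (s v)) \<or>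
          (\<exists>s\<in>plots Z2 n V. \<forall>v\<in>V. (?F \<circ> q) v = glue_in2 Z1 Y' g Z2 (s v))"
      using alt
    proof
      assume "\<exists>r\<in>plots X1 n V. \<forall>v\<in>V. q v = glue_in1 X1 Y f X2 (r v)"
      then obtain r where r: "r \<in> plots X1 n V" "\<forall>v\<in>V. q v = glue_in1 X1 Y f X2 (r v)" by blast
      have "\<forall>v\<in>V. (?F \<circ> q) v = glue_in1 Z1 Y' g Z2 ((\<psi>1 \<circ> r) v)"
        using r(2) diffeological_space.plot_values[OF X(1) r(1)]
        by (auto simp: F_in1 Pi_iff)
      moreover have "\<psi>1 \<circ> r \<in> plots Z1 n V"
        using smooth(1) r(1) by (auto simp: smooth_map_def)
      ultimately show ?thesis by blast
    next
      assume "\<exists>r\<in>plots X2 n V. \<forall>v\<in>V. q v = glue_in2 X1 Y f X2 (r v)"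
      then obtain r where r: "r \<in> plots X2 n V" "\<forall>v\<in>V. q v = glue_in2 X1 Y f X2 (r v)" by blast
      have "\<forall>v\<in>V. (?F \<circ> q) v = glue_in2 Z1 Y' g Z2 ((\<psi>2 \<circ> r) v)"
        using r(2) diffeological_space.plot_values[OF X(2) r(1)]
        by (auto simp: glue_map_in2 Pi_iff)
      moreover have "\<psi>2 \<circ> r \<in> plots Z2 n V"
        using smooth(2) r(1) by (auto simp: smooth_map_def)
      ultimately show ?thesis by blast
    qed
    then show "\<exists>V. openin (Euclidean_space n) V \<and> u \<in> V \<and> V \<subseteq> U \<and>
        ((\<exists>s\<in>plots Z1 n V. \<forall>v\<in>V. (?F \<circ> q) v = glue_in1 Z1 Y' g Z2 (s v)) \<or>
         (\<exists>s\<in>plots Z2 n V. \<forall>v\<in>V. (?F \<circ> q) v = glue_in2 Z1 Y' g Z2 (s v)))"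
      using V by blast
  qed
  moreover have "?F \<in> extensional (points (glue X1 Y f X2))"
    by (simp add: glue_map_def)
  ultimately show ?thesis
    by (auto simp: smooth_maps_def smooth_map_def)
qed

section \<open>Families of compatible pairs\<close>

lemma continuous_map_Euclidean_component:
  "continuous_map (Euclidean_space n) euclideanreal (\<lambda>w. w i)"
  unfolding Euclidean_space_def
  by (intro continuous_map_from_subtopology continuous_map_product_projection) simp

lemma continuous_map_left_part:
  "continuous_map (Euclidean_space (n + m)) (Euclidean_space n) (left_part n)"
proof -
  have "continuous_map (Euclidean_space (n + m)) euclideanreal (\<lambda>w. left_part n w i)" for i
    by (cases "i < n") (simp_all add: left_part_def continuous_map_Euclidean_component)
  then show ?thesis
    unfolding Euclidean_space_def[of n] continuous_map_in_subtopology
    by (auto simp: continuous_map_componentwise_UNIV left_part_def)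
qed

lemma continuous_map_right_part:
  "continuous_map (Euclidean_space (n + m)) (Euclidean_space m) (right_part n)"
proof -
  have "continuous_map (Euclidean_space (n + m)) euclideanreal (\<lambda>w. right_part n w i)" for i
    by (simp add: right_part_def continuous_map_Euclidean_component)
  then show ?thesis
    unfolding Euclidean_space_def[of m] continuous_map_in_subtopology
    by (auto simp: continuous_map_componentwise_UNIV right_part_def topspace_Euclidean_space)
qed

lemma openin_box_product:
  assumes "openin (Euclidean_space n) U" "openin (Euclidean_space m) U'"
  shows "openin (Euclidean_space (n + m)) (box_product n U m U')"
proof -
  have "box_product n U m U' =
      {w \<in> topspace (Euclidean_space (n + m)). left_part n w \<in> U} \<inter>
      {w \<in> topspace (Euclidean_space (n + m)). right_part n w \<in> U'}"
    by (auto simp: box_product_def)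
  then show ?thesis
    using assms
    by (simp add: openin_Int openin_continuous_map_preimage[OF continuous_map_left_part]
        openin_continuous_map_preimage[OF continuous_map_right_part])
qed

theorem theorem4p6:
  fixes X1 :: "'a dspace" and X2 :: "'b dspace" and Z1 :: "'c dspace" and Z2 :: "'d dspace"
    and Y :: "'a set" and f :: "'a \<Rightarrow> 'b" and Y' :: "'c set" and g :: "'c \<Rightarrow> 'd"
  assumes "diffeological_space X1" and "diffeological_space X2"
    and "diffeological_space Z1" and "diffeological_space Z2"
    and "Y \<subseteq> points X1" and "smooth_map (sub_dspace X1 Y) X2 f"
    and "Y' \<subseteq> points Z1" and "smooth_map (sub_dspace Z1 Y') Z2 g"
  shows "smooth_map (compatible_dspace X1 Y f X2 Z1 Y' g Z2)
           (fun_dspace (glue X1 Y f X2) (glue Z1 Y' g Z2))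
           (\<lambda>(\<psi>1, \<psi>2). glue_map X1 Y f X2 Z1 Y' g Z2 \<psi>1 \<psi>2)"
    (is "smooth_map _ (fun_dspace ?X ?Z) ?F")
proof -
  let ?C = "compatible_pairs X1 Y f X2 Z1 Y' g Z2"
  have glue: "Y \<subseteq> points X1" "f \<in> Y \<rightarrow> points X2" "Y' \<subseteq> points Z1" "g \<in> Y' \<rightarrow> points Z2"
    using assms(5-8) by (auto simp: smooth_map_def sub_dspace_def)
  have F_smooth: "?F \<psi> \<in> smooth_maps ?X ?Z" if "\<psi> \<in> ?C" for \<psi>
    using glue_map_smooth[OF assms(1,2) glue] that by (cases \<psi>) auto
  have F_in1: "?F \<psi> (glue_in1 X1 Y f X2 x) = glue_in1 Z1 Y' g Z2 (fst \<psi> x)"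
    if "\<psi> \<in> ?C" "x \<in> points X1" for \<psi> x
    using glue_map_in1[OF glue] that by (cases \<psi>) auto
  have F_in2: "?F \<psi> (glue_in2 X1 Y f X2 x) = glue_in2 Z1 Y' g Z2 (snd \<psi> x)"
    if "x \<in> points X2" for \<psi> x
    using that by (cases \<psi>) (simp add: glue_map_in2)
  have "?F \<circ> p \<in> plots (fun_dspace ?X ?Z) n U"
    if "p \<in> plots (compatible_dspace X1 Y f X2 Z1 Y' g Z2) n U" for p n U
  proof -
    have p1: "fst \<circ> p \<in> plots (fun_dspace X1 Z1) n U"
      and p2: "snd \<circ> p \<in> plots (fun_dspace X2 Z2) n U"
      and pC: "\<And>u. u \<in> U \<Longrightarrow> p u \<in> ?C"
      using that by (auto simp: compatible_dspace_def sub_dspace_def prod_dspace_def)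
    have U: "openin (Euclidean_space n) U"
      using p1 by (simp add: fun_dspace_def)
    have "(\<lambda>w. ?F (p (left_part n w)) (q (right_part n w))) \<in> plots ?Z (n + m) (box_product n U m U')"
      (is "?E \<in> _") if q: "q \<in> plots ?X m U'" for q m U'
      unfolding plots_glue_iff
    proof (intro conjI ballI)
      show "openin (Euclidean_space (n + m)) (box_product n U m U')"
        using q U by (simp add: plots_glue_iff openin_box_product)
      fix w assume w: "w \<in> box_product n U m U'"
      then have "right_part n w \<in> U'"
        by (simp add: box_product_def)
      then obtain V where V: "openin (Euclidean_space m) V" "right_part n w \<in> V" "V \<subseteq> U'"
        and alt: "(\<exists>r\<in>plots X1 m V. \<forall>v\<in>V. q v = glue_in1 X1 Y f X2 (r v)) \<or>
                  (\<exists>r\<in>plots X2 m V. \<forall>v\<in>V. q v = glue_in2 X1 Y f X2 (r v))"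
        using q unfolding plots_glue_iff by blast
      \<comment> \<open>Only the argument of the glued maps has to be localised; the parameter of the family
        keeps its whole range \<open>U\<close>.\<close>
      let ?B = "box_product n U m V"
      have B: "openin (Euclidean_space (n + m)) ?B" "w \<in> ?B" "?B \<subseteq> box_product n U m U'"
        using U V w by (auto simp: openin_box_product) (auto simp: box_product_def)
      have "(\<exists>s\<in>plots Z1 (n + m) ?B. \<forall>v\<in>?B. ?E v = glue_in1 Z1 Y' g Z2 (s v)) \<or>
            (\<exists>s\<in>plots Z2 (n + m) ?B. \<forall>v\<in>?B. ?E v = glue_in2 Z1 Y' g Z2 (s v))"
        using alt
      proof
        assume "\<exists>r\<in>plots X1 m V. \<forall>v\<in>V. q v = glue_in1 X1 Y f X2 (r v)"
        then obtain r where r: "r \<in> plots X1 m V" "\<forall>v\<in>V. q v = glue_in1 X1 Y f X2 (r v)" by blast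
        let ?s = "\<lambda>w. (fst \<circ> p) (left_part n w) (r (right_part n w))"
        have "\<forall>v\<in>?B. ?E v = glue_in1 Z1 Y' g Z2 (?s v)"
        proof
          fix v assume v: "v \<in> ?B"
          have "left_part n v \<in> U" "right_part n v \<in> V"
            using v by (auto simp: box_product_def)
          then show "?E v = glue_in1 Z1 Y' g Z2 (?s v)"
            using r(2) diffeological_space.plot_values[OF assms(1) r(1)]
            by (simp add: F_in1[OF pC] Pi_iff)
        qed
        moreover have "?s \<in> plots Z1 (n + m) ?B"
          using p1 r(1) unfolding fun_dspace_def by simp
        ultimately show ?thesis by (intro disjI1 bexI[of _ ?s])
      next
        assume "\<exists>r\<in>plots X2 m V. \<forall>v\<in>V. q v = glue_in2 X1 Y f X2 (r v)"
        then obtain r where r: "r \<in> plots X2 m V" "\<forall>v\<in>V. q v = glue_in2 X1 Y f X2 (r v)" by blast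
        let ?s = "\<lambda>w. (snd \<circ> p) (left_part n w) (r (right_part n w))"
        have "\<forall>v\<in>?B. ?E v = glue_in2 Z1 Y' g Z2 (?s v)"
        proof
          fix v assume v: "v \<in> ?B"
          have "right_part n v \<in> V"
            using v by (auto simp: box_product_def)
          then show "?E v = glue_in2 Z1 Y' g Z2 (?s v)"
            using r(2) diffeological_space.plot_values[OF assms(2) r(1)]
            by (simp add: F_in2 Pi_iff)
        qed
        moreover have "?s \<in> plots Z2 (n + m) ?B"
          using p2 r(1) unfolding fun_dspace_def by simp
        ultimately show ?thesis by (intro disjI2 bexI[of _ ?s])
      qed
      then show "\<exists>V. openin (Euclidean_space (n + m)) V \<and> w \<in> V \<and> V \<subseteq> box_product n U m U' \<and>
          ((\<exists>s\<in>plots Z1 (n + m) V. \<forall>v\<in>V. ?E v = glue_in1 Z1 Y' g Z2 (s v)) \<or>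
           (\<exists>s\<in>plots Z2 (n + m) V. \<forall>v\<in>V. ?E v = glue_in2 Z1 Y' g Z2 (s v)))"
        using B by blast
    qed
    then show ?thesis
      using U pC F_smooth by (simp add: fun_dspace_def Pi_iff)
  qed
  moreover have "?F \<in> points (compatible_dspace X1 Y f X2 Z1 Y' g Z2) \<rightarrow> points (fun_dspace ?X ?Z)"
    using F_smooth by (simp add: compatible_dspace_def sub_dspace_def fun_dspace_def Pi_iff)
  ultimately show ?thesis
    unfolding smooth_map_def by blast
qed

end
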